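(* Let $n\ge1$ and consider the Boolean cube $\{0,1\}^n$. For every $E\subsetneq[0,n]$, $$\mathsf{EHC}_n(E)=|E|-\max\{i\in[0,n]:T_{n,i}\subseteq E\}.$$
   Context: For integers $a\le b$, $[a,b]$ denotes the set of integers $t$ with $a\le t\le b$ (and $[a,b]=\emptyset$ if $a>b$). For $E\subseteq[0,n]$ let $\underline{E}\subseteq\{0,1\}^n$ be the set of points whose Hamming weight lies in $E$. A family $\mathcal{H}$ of (affine) hyperplanes in $\mathbb{R}^n$ is an exact hyperplane cover of $\underline{E}$ if $\underline{E}=\big(\bigcup_{H\in\mathcal{H}}H\big)\cap\{0,1\}^n$. $\mathsf{EHC}_n(E)$ denotes the minimum size of an exact hyperplane cover of $\underline{E}$. For $i\in[0,n]$, $T_{n,i}=[0,i-1]\cup[n-i+1,n]$ (so $T_{n,0}=\emptyset$). *)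

theory Defs
  imports "HOL-Analysis.Analysis"
begin

text \<open>
  The dimension \<open>n \<ge> 1\<close> is rendered as \<open>CARD('n)\<close> for a finite index type \<open>'n\<close>, so that
  \<open>real ^ 'n\<close> is Euclidean \<open>n\<close>-space; index types are nonempty, hence \<open>n \<ge> 1\<close>.
\<close>

definition cube :: "(real ^ 'n) set" where
  "cube = {x. \<forall>j. x $ j \<in> {0, 1}}"

definition hamming_weight :: "real ^ 'n \<Rightarrow> nat" where
  "hamming_weight x = card {j. x $ j \<noteq> 0}"

definition symmetric_set :: "nat set \<Rightarrow> (real ^ 'n) set" where
  "symmetric_set E = {x \<in> cube. hamming_weight x \<in> E}"

definition hyperplane :: "(real ^ 'n) set \<Rightarrow> bool" where
  "hyperplane H \<longleftrightarrow> (\<exists>a b. a \<noteq> 0 \<and> H = {x. a \<bullet> x = b})"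

definition exact_hyperplane_cover :: "(real ^ 'n) set set \<Rightarrow> nat set \<Rightarrow> bool" where
  "exact_hyperplane_cover \<H> E \<longleftrightarrow>
     (\<forall>H\<in>\<H>. hyperplane H) \<and> symmetric_set E = \<Union>\<H> \<inter> cube"

text \<open>
  The first argument only carries the dimension. Infinite families are excluded explicitly
  because \<open>card\<close> is \<open>0\<close> on infinite sets; by \<open>finite_exact_hyperplane_cover_exists\<close> below
  the minimum is over a nonempty set.
\<close>

definition EHC :: "'n::finite itself \<Rightarrow> nat set \<Rightarrow> nat" where
  "EHC _ E = (LEAST m. \<exists>\<H> :: (real ^ 'n) set set.
                finite \<H> \<and> exact_hyperplane_cover \<H> E \<and> card \<H> = m)"

text \<open>
  Used for \<open>i \<le> n\<close> only, where \<open>n - i\<close> is not truncated. The half-open interval is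
  \<open>[0, i - 1]\<close> over the integers, in particular empty for \<open>i = 0\<close>.
\<close>

definition T :: "nat \<Rightarrow> nat \<Rightarrow> nat set" where
  "T n i = {0..<i} \<union> {n - i + 1..n}"

lemma finite_exact_hyperplane_cover_exists:
  assumes "E \<subseteq> {0..CARD('n::finite)}"
  shows "\<exists>\<H> :: (real ^ 'n) set set. finite \<H> \<and> exact_hyperplane_cover \<H> E"
proof -
  define L where "L k = {x :: real ^ 'n. 1 \<bullet> x = real k}" for k
  have w: "1 \<bullet> x = real (hamming_weight x)" if "x \<in> cube" for x :: "real ^ 'n"
  proof -
    have "1 \<bullet> x = (\<Sum>j\<in>UNIV. x $ j)"
      by (simp add: inner_vec_def)
    also have "\<dots> = (\<Sum>j\<in>UNIV. if x $ j \<noteq> 0 then 1 else 0)"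
      using that by (intro sum.cong) (auto simp: cube_def)
    also have "\<dots> = real (hamming_weight x)"
      by (simp add: hamming_weight_def sum.If_cases)
    finally show ?thesis .
  qed
  have "hyperplane (L k)" for k
    unfolding hyperplane_def L_def by (rule exI[of _ 1]) (auto simp: vec_eq_iff)
  moreover have "symmetric_set E = \<Union>(L ` E) \<inter> cube"
    using w by (auto simp: symmetric_set_def L_def)
  ultimately have "exact_hyperplane_cover (L ` E) E"
    by (auto simp: exact_hyperplane_cover_def)
  moreover have "finite (L ` E)"
    using assms finite_subset by blast
  ultimately show ?thesis by blast
qed

end

theory Submission
  imports Defs
begin

text \<open>
  Let \<open>\<mu>\<close> be the maximal \<open>i\<close>, so that \<open>\<mu>\<close> or \<open>n - \<mu>\<close> is not in \<open>E\<close>.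

  Upper bound: the layers of \<open>E\<close> outside \<open>T\<^bsub>n,\<mu>\<^esub>\<close> are covered one by one, and \<open>T\<^bsub>n,i\<^esub>\<close> by \<open>i\<close> hyperplanes:
  on the cube, \<open>T\<^bsub>n,i+1\<^esub>\<close> is the union of \<open>T\<^bsub>n-1,i\<^esub> \<times> {0,1}\<close> and of the hyperplane
  \<open>x\<^sub>1 + \<dots> + x\<^bsub>n-1\<^esub> - (n - 1 - 2i) x\<^sub>n = i\<close>.

  Lower bound: fix an uncovered point \<open>y\<close> of weight \<open>\<mu>\<close> (or \<open>n - \<mu>\<close>) and restrict to the subcube of the
  points above (or below) \<open>y\<close>, of dimension \<open>n - \<mu>\<close>. Completing the cover by the missing layers gives
  hyperplanes that cover every point of the subcube but \<open>y\<close>, and by Alon and Fueredi there are at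
  least \<open>n - \<mu>\<close> of these, because the alternating sum over a \<open>d\<close>-dimensional cube of a product of
  fewer than \<open>d\<close> affine functions vanishes.
\<close>

section \<open>Alternating sums over a cube and the Alon-Fueredi bound\<close>

text \<open>Induction on the number of factors: expanding one factor leaves a multiple of the sum
  for the remaining product, and for each \<open>j\<close> a multiple of that sum over the sets
  containing \<open>j\<close>. The latter live on \<open>S - {j}\<close>, so one factor and one
  dimension disappear together; hence \<open>S\<close> and \<open>c\<close> vary in the
  induction.\<close>

lemma alternating_sum_prod_affine_eq_0:
  fixes c :: "'i \<Rightarrow> real" and a :: "'i \<Rightarrow> 'a \<Rightarrow> real"
  assumes "finite I" "finite S" "card I < card S"
  shows "(\<Sum>X\<in>Pow S. (-1) ^ card X * (\<Prod>i\<in>I. c i + sum (a i) X)) = 0"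
  using assms
proof (induction I arbitrary: S c rule: finite_induct)
  case empty
  \<comment> \<open>Adding or removing \<open>s\<close> pairs off the subsets of \<open>S\<close>
    with opposite signs.\<close>
  then obtain s where s: "s \<in> S" by (metis card.empty card_gt_0_iff ex_in_conv)
  define S' where "S' = S - {s}"
  have S: "S = insert s S'" "s \<notin> S'" "finite S'"
    using s empty by (auto simp: S'_def)
  have "(\<Sum>X\<in>insert s ` Pow S'. (-1) ^ card X :: real) = (\<Sum>X\<in>Pow S'. (-1) ^ card (insert s X))"
    using S by (intro sum.reindex_cong[of "insert s"]) (auto simp: inj_on_def)
  also have "\<dots> = (\<Sum>X\<in>Pow S'. - ((-1) ^ card X))"
  proof (rule sum.cong)
    fix X assume "X \<in> Pow S'"
    then have "finite X" "s \<notin> X" using S finite_subset by auto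
    then show "(-1 :: real) ^ card (insert s X) = - ((-1) ^ card X)" by simp
  qed simp
  finally have "(\<Sum>X\<in>insert s ` Pow S'. (-1) ^ card X :: real) = - (\<Sum>X\<in>Pow S'. (-1) ^ card X)"
    by (simp add: sum_negf)
  moreover have "(\<Sum>X\<in>Pow S. (-1) ^ card X :: real)
      = (\<Sum>X\<in>Pow S'. (-1) ^ card X) + (\<Sum>X\<in>insert s ` Pow S'. (-1) ^ card X)"
    unfolding S(1) Pow_insert using S by (intro sum.union_disjoint) auto
  ultimately show ?case by simp
next
  case (insert i I)
  define g where "g X = (\<Prod>k\<in>I. c k + sum (a k) X)" for X
  have "card I < card S" using insert by simp
  then have g0: "(\<Sum>X\<in>Pow S. (-1) ^ card X * g X) = 0"
    unfolding g_def using insert by blast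
  have gj: "(\<Sum>X\<in>{X\<in>Pow S. j \<in> X}. (-1) ^ card X * g X) = 0" if j: "j \<in> S" for j
  proof -
    have fin: "finite X" "j \<notin> X" if "X \<in> Pow (S - {j})" for X
      using that insert.prems(1) finite_subset by auto
    have "(\<Sum>X\<in>{X\<in>Pow S. j \<in> X}. (-1) ^ card X * g X)
        = (\<Sum>X\<in>Pow (S - {j}). (-1) ^ card (insert j X) * g (insert j X))"
    proof (rule sum.reindex_bij_witness[of _ "insert j" "\<lambda>X. X - {j}"])
    qed (use j in \<open>auto simp: insert_absorb\<close>)
    \<comment> \<open>Inserting \<open>j\<close> flips the sign and is absorbed into the constants,
      \<open>c k\<close> becoming \<open>c k + a k j\<close>.\<close>
    also have "\<dots> = - (\<Sum>X\<in>Pow (S - {j}). (-1) ^ card X * (\<Prod>k\<in>I. (c k + a k j) + sum (a k) X))"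
      unfolding sum_negf[symmetric] g_def using fin by (intro sum.cong) (auto simp: add.assoc)
    also have "(\<Sum>X\<in>Pow (S - {j}). (-1) ^ card X * (\<Prod>k\<in>I. (c k + a k j) + sum (a k) X)) = 0"
      using insert j by (intro insert.IH) auto
    finally show ?thesis by simp
  qed
  have "(\<Sum>X\<in>Pow S. (-1) ^ card X * (\<Prod>k\<in>insert i I. c k + sum (a k) X))
      = (\<Sum>X\<in>Pow S. c i * ((-1) ^ card X * g X)
          + (\<Sum>j\<in>S. a i j * (if j \<in> X then (-1) ^ card X * g X else 0)))"
  proof (rule sum.cong)
    fix X assume X: "X \<in> Pow S"
    have "sum (a i) X = (\<Sum>j\<in>S. if j \<in> X then a i j else 0)"
      using X insert.prems(1) by (subst sum.inter_restrict[symmetric]) (auto simp: Int_absorb1)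
    then have "(-1) ^ card X * g X * sum (a i) X
        = (\<Sum>j\<in>S. a i j * (if j \<in> X then (-1) ^ card X * g X else 0))"
      by (simp only: sum_distrib_left) (intro sum.cong, auto)
    then show "(-1) ^ card X * (\<Prod>k\<in>insert i I. c k + sum (a k) X)
        = c i * ((-1) ^ card X * g X)
          + (\<Sum>j\<in>S. a i j * (if j \<in> X then (-1) ^ card X * g X else 0))"
      using insert.hyps by (simp add: g_def algebra_simps)
  qed simp
  also have "\<dots> = c i * (\<Sum>X\<in>Pow S. (-1) ^ card X * g X)
      + (\<Sum>j\<in>S. a i j * (\<Sum>X\<in>Pow S. if j \<in> X then (-1) ^ card X * g X else 0))"
    by (simp only: sum.distrib sum_distrib_left sum.swap[of _ S])
  also have "\<dots> = 0"
  proof -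
    have "(\<Sum>X\<in>Pow S. if j \<in> X then (-1) ^ card X * g X else 0) = 0" if "j \<in> S" for j
      using gj[OF that] insert.prems(1) by (subst sum.inter_filter[symmetric]) auto
    then show ?thesis by (simp add: g0)
  qed
  finally show ?case .
qed

text \<open>Alon-Fueredi, applied after adding the function \<open>card X - w\<close> for each
  weight \<open>w\<close> in \<open>{1..card S} - F\<close>: the product then vanishes everywhere
  except at the empty set, so at least \<open>card S\<close> factors are needed, and only
  \<open>card S - card F\<close> of them were added.\<close>

lemma card_weights_le_card_affine_cover:
  fixes c :: "'i \<Rightarrow> real" and a :: "'i \<Rightarrow> 'a \<Rightarrow> real"
  assumes "finite I" "finite S" and F: "F \<subseteq> {1..card S}"
    and base: "\<And>i. i \<in> I \<Longrightarrow> c i \<noteq> 0"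
    and cover: "\<And>X. X \<subseteq> S \<Longrightarrow> card X \<in> F \<Longrightarrow> \<exists>i\<in>I. c i + sum (a i) X = 0"
  shows "card F \<le> card I"
proof (rule ccontr)
  assume "\<not> card F \<le> card I"
  define W where "W = {1..card S} - F"
  define J where "J = I <+> W"
  define c' where "c' = case_sum c (\<lambda>w. - real w)"
  define a' where "a' = case_sum a (\<lambda>(w :: nat) j. 1)"
  have "finite F" using F finite_subset by blast
  then have "card F \<le> card S" "card W = card S - card F"
    using F card_mono[OF _ F] by (auto simp: W_def card_Diff_subset)
  moreover have "finite W" by (simp add: W_def)
  ultimately have "finite J" "card J < card S"
    using \<open>\<not> card F \<le> card I\<close> \<open>finite I\<close> by (auto simp: J_def card_Plus)
  then have "(\<Sum>X\<in>Pow S. (-1) ^ card X * (\<Prod>i\<in>J. c' i + sum (a' i) X)) = 0"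
    using \<open>finite S\<close> by (intro alternating_sum_prod_affine_eq_0)
  moreover have "(\<Prod>i\<in>J. c' i + sum (a' i) X) = 0" if X: "X \<in> Pow S - {{}}" for X
  proof -
    have "card X \<in> {1..card S}"
      using X \<open>finite S\<close> card_mono[of S X] finite_subset[of X S]
      by (auto simp: Suc_le_eq card_gt_0_iff)
    then consider "card X \<in> F" | "card X \<in> W" by (auto simp: W_def)
    then have "\<exists>i\<in>J. c' i + sum (a' i) X = 0"
    proof cases
      case 1
      then obtain i where "i \<in> I" "c i + sum (a i) X = 0" using cover X by blast
      then show ?thesis by (intro bexI[of _ "Inl i"]) (auto simp: J_def c'_def a'_def)
    next
      case 2
      then show ?thesis by (intro bexI[of _ "Inr (card X)"]) (auto simp: J_def c'_def a'_def)
    qed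
    then show ?thesis using \<open>finite J\<close> by (simp add: prod_zero_iff)
  qed
  \<comment> \<open>Only the term of the empty set survives, and its value is the product of the
    constants.\<close>
  ultimately have "(\<Prod>i\<in>J. c' i) = 0"
    using \<open>finite S\<close> by (subst (asm) sum.remove[of _ "{}"]) auto
  then show False
    using \<open>finite J\<close> base by (auto simp: prod_zero_iff J_def c'_def W_def)
qed

section \<open>Cube points as sets, and the lower bound on subcubes\<close>

lemma hyperplaneI: "a \<noteq> 0 \<Longrightarrow> hyperplane {x. a \<bullet> x = b}"
  unfolding hyperplane_def by blast

lemma sum_cube:
  assumes "x \<in> cube"
  shows "(\<Sum>j\<in>A. x $ j) = real (card {j\<in>A. x $ j \<noteq> 0})"
proof -
  have "(\<Sum>j\<in>A. x $ j) = (\<Sum>j\<in>A. if x $ j \<noteq> 0 then 1 else 0)"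
    using assms by (intro sum.cong) (auto simp: cube_def)
  also have "\<dots> = real (card {j\<in>A. x $ j \<noteq> 0})"
    by (simp add: sum.If_cases Int_def)
  finally show ?thesis .
qed

definition vec_of_set :: "'n set \<Rightarrow> real ^ 'n" where
  "vec_of_set X = (\<chi> j. if j \<in> X then 1 else 0)"

lemma vec_of_set_in_cube: "vec_of_set X \<in> cube"
  by (auto simp: vec_of_set_def cube_def)

lemma hamming_weight_vec_of_set: "hamming_weight (vec_of_set X) = card X"
  by (simp add: vec_of_set_def hamming_weight_def)

lemma inner_vec_of_set: "a \<bullet> vec_of_set X = (\<Sum>j\<in>X. a $ j)"
  by (simp add: inner_vec_def vec_of_set_def if_distrib sum.If_cases cong: if_cong)

text \<open>Common form of the two restrictions: \<open>X\<close> runs through a subcube with origin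
  \<open>Y\<close> via \<open>Z X\<close>, where \<sigma> is 1 if \<open>X\<close> is added to
  \<open>Y\<close> and -1 if it is removed. Assumption \<open>Z\<close> says that linear forms
  become affine functions of \<open>X\<close>.\<close>

lemma card_le_card_exact_hyperplane_cover:
  fixes \<H> :: "(real ^ 'n) set set" and \<sigma> :: real
  assumes "finite \<H>" and cov: "exact_hyperplane_cover \<H> E"
    and base: "hamming_weight (vec_of_set Y :: real ^ 'n) \<notin> E"
    and F: "F \<subseteq> {1..card S}"
    and Z: "\<And>a :: real ^ 'n. \<And>X. X \<subseteq> S \<Longrightarrow> (\<Sum>j\<in>Z X. a $ j) = (\<Sum>j\<in>Y. a $ j) + \<sigma> * (\<Sum>j\<in>X. a $ j)"
    and ZF: "\<And>X. X \<subseteq> S \<Longrightarrow> card X \<in> F \<Longrightarrow> card (Z X) \<in> E"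
  shows "card F \<le> card \<H>"
proof -
  have "\<exists>a b. \<forall>x. x \<in> H \<longleftrightarrow> a \<bullet> x = b" if "H \<in> \<H>" for H
  proof -
    have "hyperplane H" using that cov by (simp add: exact_hyperplane_cover_def)
    then obtain a b where "H = {x. a \<bullet> x = b}" unfolding hyperplane_def by blast
    then have "\<forall>x. x \<in> H \<longleftrightarrow> a \<bullet> x = b" by simp
    then show ?thesis by blast
  qed
  then obtain a b where "\<And>H x. H \<in> \<H> \<Longrightarrow> x \<in> H \<longleftrightarrow> a H \<bullet> x = b H" by metis
  then have mem: "vec_of_set X \<in> H \<longleftrightarrow> (\<Sum>j\<in>X. a H $ j) = b H" if "H \<in> \<H>" for H X
    using that by (simp add: inner_vec_of_set)
  have covered: "(\<exists>H\<in>\<H>. vec_of_set X \<in> H) \<longleftrightarrow> card X \<in> E" for X :: "'n set"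
  proof -
    have "vec_of_set X \<in> symmetric_set E \<longleftrightarrow> vec_of_set X \<in> \<Union>\<H> \<inter> cube"
      using cov by (simp add: exact_hyperplane_cover_def)
    then show ?thesis
      by (simp add: symmetric_set_def vec_of_set_in_cube hamming_weight_vec_of_set)
  qed
  show ?thesis
  proof (rule card_weights_le_card_affine_cover[OF \<open>finite \<H>\<close> finite[of S] F,
        where c = "\<lambda>H. (\<Sum>j\<in>Y. a H $ j) - b H" and a = "\<lambda>H j. \<sigma> * a H $ j"])
    fix H assume "H \<in> \<H>"
    then show "(\<Sum>j\<in>Y. a H $ j) - b H \<noteq> 0"
      using covered[of Y] base mem[of H Y] by (auto simp: hamming_weight_vec_of_set)
  next
    fix X assume X: "X \<subseteq> S" "card X \<in> F"
    then obtain H where H: "H \<in> \<H>" "vec_of_set (Z X) \<in> H"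
      using ZF covered by blast
    have "(\<Sum>j\<in>Y. a H $ j) - b H + (\<Sum>j\<in>X. \<sigma> * a H $ j) = 0"
      using H mem[of H "Z X"] Z[OF X(1), of "a H"] by (simp add: sum_distrib_left)
    then show "\<exists>H\<in>\<H>. (\<Sum>j\<in>Y. a H $ j) - b H + (\<Sum>j\<in>X. \<sigma> * a H $ j) = 0"
      using H by blast
  qed
qed

lemma card_exact_hyperplane_cover_ge_above:
  fixes \<H> :: "(real ^ 'n) set set"
  assumes "finite \<H>" "exact_hyperplane_cover \<H> E" "k \<notin> E" "k \<le> CARD('n)"
  shows "card (E \<inter> {k..CARD('n)}) \<le> card \<H>"
proof -
  obtain Y :: "'n set" where Y: "card Y = k"
    using obtain_subset_with_card_n[OF assms(4)] by metis
  \<comment> \<open>Weights measured from \<open>Y\<close>; since \<open>k \<notin> E\<close>, the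
    value 0 does not occur.\<close>
  define F where "F = (\<lambda>w. w - k) ` (E \<inter> {k..CARD('n)})"
  have "card F = card (E \<inter> {k..CARD('n)})"
    unfolding F_def by (intro card_image) (auto simp: inj_on_def)
  moreover have "card F \<le> card \<H>"
  proof (rule card_le_card_exact_hyperplane_cover[OF assms(1,2), where S = "- Y" and Z = "\<lambda>X. Y \<union> X" and \<sigma> = 1])
    show "hamming_weight (vec_of_set Y :: real ^ 'n) \<notin> E"
      using assms(3) Y by (simp add: hamming_weight_vec_of_set)
    show "F \<subseteq> {1..card (- Y)}"
    proof
      fix v assume "v \<in> F"
      then obtain w where w: "w \<in> E" "k \<le> w" "w \<le> CARD('n)" "v = w - k" by (auto simp: F_def)
      with assms(3) have "w \<noteq> k" by auto
      then show "v \<in> {1..card (- Y)}"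
        using w Y by (auto simp: Compl_eq_Diff_UNIV card_Diff_subset)
    qed
    fix X assume X: "X \<subseteq> - Y"
    show "(\<Sum>j\<in>Y \<union> X. a $ j) = (\<Sum>j\<in>Y. a $ j) + 1 * (\<Sum>j\<in>X. a $ j)" for a :: "real ^ 'n"
      using X by (simp, intro sum.union_disjoint) auto
    have "card (Y \<union> X) = k + card X"
      using X Y by (subst card_Un_disjoint) auto
    then show "card (Y \<union> X) \<in> E" if "card X \<in> F"
      using that by (auto simp: F_def)
  qed
  ultimately show ?thesis by simp
qed

lemma card_exact_hyperplane_cover_ge_below:
  fixes \<H> :: "(real ^ 'n) set set"
  assumes "finite \<H>" "exact_hyperplane_cover \<H> E" "k \<notin> E" "k \<le> CARD('n)"
  shows "card (E \<inter> {0..k}) \<le> card \<H>"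
proof -
  obtain Y :: "'n set" where Y: "card Y = k"
    using obtain_subset_with_card_n[OF assms(4)] by metis
  \<comment> \<open>Here the distance is the number of elements removed from \<open>Y\<close>, again
    never 0.\<close>
  define F where "F = (\<lambda>w. k - w) ` (E \<inter> {0..k})"
  have "card F = card (E \<inter> {0..k})"
    unfolding F_def by (intro card_image) (auto simp: inj_on_def)
  moreover have "card F \<le> card \<H>"
  proof (rule card_le_card_exact_hyperplane_cover[OF assms(1,2), where S = Y and Z = "\<lambda>X. Y - X" and \<sigma> = "-1"])
    show "hamming_weight (vec_of_set Y :: real ^ 'n) \<notin> E"
      using assms(3) Y by (simp add: hamming_weight_vec_of_set)
    show "F \<subseteq> {1..card Y}"
    proof
      fix v assume "v \<in> F"
      then obtain w where w: "w \<in> E" "w \<le> k" "v = k - w" by (auto simp: F_def)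
      with assms(3) have "w \<noteq> k" by auto
      then show "v \<in> {1..card Y}" using w Y by auto
    qed
    fix X assume X: "X \<subseteq> Y"
    show "(\<Sum>j\<in>Y - X. a $ j) = (\<Sum>j\<in>Y. a $ j) + -1 * (\<Sum>j\<in>X. a $ j)" for a :: "real ^ 'n"
      using X by (simp add: sum_diff)
    have "card (Y - X) = k - card X"
      using X Y by (simp add: card_Diff_subset)
    then show "card (Y - X) \<in> E" if "card X \<in> F"
      using that by (auto simp: F_def)
  qed
  ultimately show ?thesis by simp
qed

section \<open>Constructing small covers\<close>

text \<open>Counting weight only on a coordinate set \<open>S\<close> lets the induction drop a
  coordinate while all hyperplanes stay in the same space.\<close>

lemma hyperplane_cover_T_coordinates:
  fixes S :: "'n::finite set"
  assumes "2 * i \<le> card S"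
  shows "\<exists>\<H> :: (real ^ 'n) set set. finite \<H> \<and> card \<H> \<le> i \<and> (\<forall>H\<in>\<H>. hyperplane H) \<and>
           (\<forall>x\<in>cube. x \<in> \<Union>\<H> \<longleftrightarrow> card {j\<in>S. x $ j \<noteq> 0} \<in> T (card S) i)"
  using assms
proof (induction i arbitrary: S)
  case 0
  show ?case by (rule exI[of _ "{}"]) (auto simp: T_def)
next
  case (Suc i)
  then have "S \<noteq> {}" by auto
  then obtain s where s: "s \<in> S" by blast
  define S' where "S' = S - {s}"
  define N where "N = card S'"
  have S: "S = insert s S'" "s \<notin> S'" "card S = Suc N" "2 * i < N"
    using s Suc.prems by (auto simp: S'_def N_def card_Diff_singleton)
  then obtain \<H> :: "(real ^ 'n) set set" where \<H>: "finite \<H>" "card \<H> \<le> i" "\<forall>H\<in>\<H>. hyperplane H"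
    "\<forall>x\<in>cube. x \<in> \<Union>\<H> \<longleftrightarrow> card {j\<in>S'. x $ j \<noteq> 0} \<in> T N i"
    using Suc.IH[of S'] unfolding N_def by (meson less_imp_le)
  \<comment> \<open>This slope makes \<open>H\<close> meet the layer \<open>i\<close> of
    \<open>S'\<close> where \<open>x $ s = 0\<close> and the layer \<open>N - i\<close> where
    \<open>x $ s = 1\<close>. In \<open>S\<close> these have weights \<open>i\<close> and
    \<open>card S - i\<close>, the two that \<open>T\<close> gains; on each facet the other one is
    already covered. As \<open>2 * i < N\<close>, the slope is positive and the normal
    nonzero.\<close>
  define r where "r = real (N - 2 * i)"
  define a :: "real ^ 'n" where "a = (\<chi> j. if j = s then - r else if j \<in> S' then 1 else 0)"
  define H where "H = {x. a \<bullet> x = real i}"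
  have "a $ s \<noteq> 0" using S by (simp add: a_def r_def)
  then have "hyperplane H" unfolding H_def by (intro hyperplaneI) auto
  have inner: "a \<bullet> x = (\<Sum>j\<in>S'. x $ j) - r * x $ s" for x
  proof -
    have "a \<bullet> x = (\<Sum>j\<in>S. a $ j * x $ j)"
      unfolding inner_vec_def by (intro sum.mono_neutral_cong_right) (auto simp: a_def S)
    also have "\<dots> = - r * x $ s + (\<Sum>j\<in>S'. a $ j * x $ j)"
      using S by (simp add: a_def)
    also have "(\<Sum>j\<in>S'. a $ j * x $ j) = (\<Sum>j\<in>S'. x $ j)"
      using S by (intro sum.cong) (auto simp: a_def)
    finally show ?thesis by simp
  qed
  have "x \<in> \<Union>(insert H \<H>) \<longleftrightarrow> card {j\<in>S. x $ j \<noteq> 0} \<in> T (card S) (Suc i)" if x: "x \<in> cube" for x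
  proof -
    define w where "w = card {j\<in>S'. x $ j \<noteq> 0}"
    have w: "w \<le> N" unfolding w_def N_def by (intro card_mono) auto
    have T: "v \<in> T k l \<longleftrightarrow> v < l \<or> k - l < v" if "v \<le> k" for v k l
      using that by (auto simp: T_def)
    have U: "x \<in> \<Union>(insert H \<H>) \<longleftrightarrow> real w - r * x $ s = real i \<or> w < i \<or> N - i < w"
      using bspec[OF \<H>(4) x] T[OF w]
      by (simp add: H_def inner sum_cube[OF x] w_def[symmetric])
    have "x $ s = 0 \<or> x $ s = 1" using x by (auto simp: cube_def)
    then show ?thesis
    proof
      assume x0: "x $ s = 0"
      then have "{j\<in>S. x $ j \<noteq> 0} = {j\<in>S'. x $ j \<noteq> 0}" using S(1) by auto
      then have "card {j\<in>S. x $ j \<noteq> 0} = w" by (simp add: w_def)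
      then show ?thesis unfolding U S(3) using x0 w S(4) by (simp add: T, linarith)
    next
      assume x1: "x $ s = 1"
      then have "{j\<in>S. x $ j \<noteq> 0} = insert s {j\<in>S'. x $ j \<noteq> 0}" using S(1) by auto
      then have "card {j\<in>S. x $ j \<noteq> 0} = Suc w" using S(2) by (simp add: w_def)
      moreover have "real w - r * x $ s = real i \<longleftrightarrow> w = N - i"
        using x1 S(4) unfolding r_def by (simp add: of_nat_diff) linarith
      ultimately show ?thesis unfolding U S(3) using w S(4) by (simp add: T, linarith)
    qed
  qed
  moreover have "card (insert H \<H>) \<le> Suc i"
    using \<H>(1,2) by (simp add: card_insert_if)
  ultimately show ?case
    using \<H>(1,3) \<open>hyperplane H\<close> by (intro exI[of _ "insert H \<H>"]) auto
qed

lemma exact_hyperplane_cover_Un: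
  assumes "exact_hyperplane_cover \<G> A" "exact_hyperplane_cover \<H> B"
  shows "exact_hyperplane_cover (\<G> \<union> \<H>) (A \<union> B)"
proof -
  have "symmetric_set (A \<union> B) = symmetric_set A \<union> (symmetric_set B :: (real ^ 'a) set)"
    by (auto simp: symmetric_set_def)
  then show ?thesis
    using assms by (simp add: exact_hyperplane_cover_def Int_Un_distrib2 ball_Un)
qed

text \<open>One hyperplane per weight; this version keeps track of the size.\<close>

lemma exact_hyperplane_cover_layers:
  assumes "finite E"
  shows "\<exists>\<H> :: (real ^ 'n) set set. finite \<H> \<and> card \<H> \<le> card E \<and> exact_hyperplane_cover \<H> E"
proof -
  define L where "L k = {x :: real ^ 'n. 1 \<bullet> x = real k}" for k
  have "hyperplane (L k)" for k
    unfolding L_def by (intro hyperplaneI) (auto simp: vec_eq_iff)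
  moreover have "1 \<bullet> x = real (hamming_weight x)" if "x \<in> cube" for x :: "real ^ 'n"
    using sum_cube[OF that, of UNIV] by (simp add: inner_vec_def hamming_weight_def)
  ultimately have "exact_hyperplane_cover (L ` E) E"
    by (auto simp: exact_hyperplane_cover_def symmetric_set_def L_def)
  then show ?thesis using assms card_image_le by blast
qed

lemma exact_hyperplane_cover_T:
  assumes "2 * i \<le> CARD('n::finite)"
  shows "\<exists>\<H> :: (real ^ 'n) set set. finite \<H> \<and> card \<H> \<le> i \<and> exact_hyperplane_cover \<H> (T CARD('n) i)"
proof -
  obtain \<H> :: "(real ^ 'n) set set" where "finite \<H>" "card \<H> \<le> i" "\<forall>H\<in>\<H>. hyperplane H"
    "\<forall>x\<in>cube. x \<in> \<Union>\<H> \<longleftrightarrow> hamming_weight x \<in> T CARD('n) i"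
    using hyperplane_cover_T_coordinates[of i "UNIV :: 'n set"] assms
    by (auto simp: hamming_weight_def)
  moreover from this have "exact_hyperplane_cover \<H> (T CARD('n) i)"
    unfolding exact_hyperplane_cover_def symmetric_set_def by blast
  ultimately show ?thesis by blast
qed

lemma card_T: "2 * i \<le> n \<Longrightarrow> card (T n i) = 2 * i"
  unfolding T_def by (subst card_Un_disjoint) auto

section \<open>Combining the bounds\<close>

theorem corollary7p2:
  fixes E :: "nat set"
  assumes "E \<subset> {0..CARD('n::finite)}"
  shows "int (EHC TYPE('n) E) =
           int (card E) - int (Max {i \<in> {0..CARD('n)}. T CARD('n) i \<subseteq> E})"
proof -
  define n where "n = CARD('n)"
  define M where "M = {i \<in> {0..n}. T n i \<subseteq> E}"
  define m where "m = Max M"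
  have "n \<ge> 1" by (simp add: n_def Suc_le_eq)
  have E: "E \<subset> {0..n}" "finite E" using assms finite_subset by (auto simp: n_def)
  have "finite M" "0 \<in> M" by (auto simp: M_def T_def)
  then have "m \<in> M" unfolding m_def by (metis Max_in empty_iff)
  have "Suc m \<notin> M" using Max_ge[OF \<open>finite M\<close>, of "Suc m"] by (auto simp: m_def)
  have "m \<le> n" and TE: "T n m \<subseteq> E" using \<open>m \<in> M\<close> by (auto simp: M_def)
  \<comment> \<open>Properness of \<open>E\<close> enters here: beyond the middle,
    \<open>T n m\<close> is all of \<open>{0..n}\<close>.\<close>
  have m2: "2 * m \<le> n"
  proof (rule ccontr)
    assume "\<not> 2 * m \<le> n"
    then have "{0..n} \<subseteq> T n m" by (auto simp: T_def)
    with TE E show False by auto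
  qed
  have gap: "m \<notin> E \<or> n - m \<notin> E"
  proof (rule ccontr)
    assume both: "\<not> (m \<notin> E \<or> n - m \<notin> E)"
    \<comment> \<open>Maximality only concerns indices up to \<open>n\<close>;
      \<open>n \<ge> 1\<close> keeps \<open>Suc m\<close> in range.\<close>
    have "Suc m \<le> n" using m2 \<open>n \<ge> 1\<close> by linarith
    have "T n (Suc m) \<subseteq> insert m (insert (n - m) (T n m))"
      using \<open>Suc m \<le> n\<close> by (auto simp: T_def)
    then have "Suc m \<in> M" using both TE \<open>Suc m \<le> n\<close> by (auto simp: M_def)
    with \<open>Suc m \<notin> M\<close> show False ..
  qed
  have cm: "card A = m \<Longrightarrow> A \<subseteq> E \<Longrightarrow> card (E - A) = card E - m" for A
    using E(2) finite_subset by (metis card_Diff_subset)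
  have lower: "card E - m \<le> card \<H>"
    if "finite \<H>" "exact_hyperplane_cover \<H> E" for \<H> :: "(real ^ 'n) set set"
    using gap
  proof
    assume "m \<notin> E"
    \<comment> \<open>Cutting at the gap loses just one of the two halves of \<open>T n m\<close>,
      that is \<open>m\<close> weights.\<close>
    have "E \<inter> {m..n} = E - {0..<m}" using E(1) by auto
    moreover have "{0..<m} \<subseteq> E" using TE by (auto simp: T_def)
    ultimately have "card (E \<inter> {m..n}) = card E - m" using cm[of "{0..<m}"] by simp
    then show ?thesis
      using card_exact_hyperplane_cover_ge_above[OF that \<open>m \<notin> E\<close>] \<open>m \<le> n\<close> by (simp add: n_def)
  next
    assume "n - m \<notin> E"
    have "E \<inter> {0..n - m} = E - {n - m + 1..n}" using E(1) by auto
    moreover have "{n - m + 1..n} \<subseteq> E" using TE by (auto simp: T_def)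
    ultimately have "card (E \<inter> {0..n - m}) = card E - m"
      using cm[of "{n - m + 1..n}"] \<open>m \<le> n\<close> by simp
    then show ?thesis
      using card_exact_hyperplane_cover_ge_below[OF that \<open>n - m \<notin> E\<close>] by (simp add: n_def)
  qed
  have cT: "card (T n m) = 2 * m" using m2 by (rule card_T)
  then have mE: "2 * m \<le> card E" using card_mono[OF E(2) TE] by simp
  obtain \<G> :: "(real ^ 'n) set set" where
    "finite \<G>" "card \<G> \<le> m" "exact_hyperplane_cover \<G> (T n m)"
    using exact_hyperplane_cover_T[where 'n = 'n, of m] m2 unfolding n_def by blast
  moreover obtain \<L> :: "(real ^ 'n) set set" where
    "finite \<L>" "card \<L> \<le> card (E - T n m)" "exact_hyperplane_cover \<L> (E - T n m)"
    using exact_hyperplane_cover_layers[of "E - T n m"] E(2) by blast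
  moreover have "T n m \<union> (E - T n m) = E" using TE by auto
  moreover have "card (E - T n m) = card E - 2 * m"
    using cT TE E(2) by (metis card_Diff_subset finite_subset)
  \<comment> \<open>The count is \<open>m + (card E - 2 * m)\<close>; \<open>mE\<close> ensures that
    the subtraction is not truncated.\<close>
  ultimately have cover: "finite (\<G> \<union> \<L>)" "exact_hyperplane_cover (\<G> \<union> \<L>) E"
    and le: "card (\<G> \<union> \<L>) \<le> card E - m"
    using exact_hyperplane_cover_Un[of \<G> "T n m" \<L> "E - T n m"] card_Un_le[of \<G> \<L>] mE by auto
  have "EHC TYPE('n) E = card E - m"
    unfolding EHC_def
  proof (rule Least_equality)
    show "\<exists>\<H> :: (real ^ 'n) set set. finite \<H> \<and> exact_hyperplane_cover \<H> E \<and> card \<H> = card E - m"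
      using cover le lower[OF cover] by (intro exI[of _ "\<G> \<union> \<L>"]) auto
  qed (use lower in blast)
  then show ?thesis using mE by (simp add: m_def M_def n_def of_nat_diff)
qed

end
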